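(* Let $D,m\ge 1$ and define $P_{D,m}\colon\bigotimes^D\mathbb{C}^m\to\mathbb{C}$ by $$P_{D,m}(v)=\sum_{\sigma_1,\dots,\sigma_D\in S_m}\Big[\prod_{j=1}^D\mathrm{sgn}(\sigma_j)\Big]\prod_{i=1}^m v(\sigma_1(i),\dots,\sigma_D(i)).$$ (1) We have $P_{D,m}(gv)=(\det g)^D P_{D,m}(v)$ for all $g\in\mathrm{GL}_m$ and $v\in\bigotimes^D\mathbb{C}^m$. (2) Let $m\ge2$. Then the polynomial $P_{D,m}$ is nonzero if and only if $D$ is even. More specifically, for $D$ even, $P_{D,m}(X_1^D+\cdots+X_m^D)=m!\neq0$.
   Context: A tensor $v\in\bigotimes^D\mathbb{C}^m$ is written in coordinates as $v=\sum_{1\le\nu_1,\dots,\nu_D\le m}v(\nu_1,\dots,\nu_D)\,e_{\nu_1}\otimes\cdots\otimes e_{\nu_D}$, where $e_1,\dots,e_m$ is the standard basis of $\mathbb{C}^m$. $\mathrm{GL}_m$ acts by $gv:=g^{\otimes D}(v)$. The form $X_1^D+\cdots+X_m^D\in\mathrm{Sym}^D\mathbb{C}^m$ is identified with the symmetric tensor $\sum_{i=1}^m e_i\otimes\cdots\otimes e_i\in\bigotimes^D\mathbb{C}^m$. *)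

theory Defs
  imports "HOL-Analysis.Analysis"
begin

text \<open>
  The tensor power of order \<open>D\<close> of \<open>\<complex>\<^sup>m\<close>, in coordinates with respect to the standard basis.
  Here \<open>m = CARD('m)\<close> and \<open>D = CARD('d)\<close>; both are at least 1 since types are nonempty.
  A multi-index \<open>(\<nu>\<^sub>1, \<dots>, \<nu>\<^sub>D)\<close> is a function \<open>\<nu> :: 'd \<Rightarrow> 'm\<close>, so the coordinate
  \<open>v(\<nu>\<^sub>1, \<dots>, \<nu>\<^sub>D)\<close> is \<open>v $ \<nu>\<close>.
\<close>
type_synonym ('d, 'm) tensor = "complex ^ ('d \<Rightarrow> 'm)"

text \<open>The decomposable tensor \<open>x\<^sub>1 \<otimes> \<dots> \<otimes> x\<^sub>D\<close>.\<close>
definition pure_tensor :: "('d::finite \<Rightarrow> complex ^ 'm::finite) \<Rightarrow> ('d, 'm) tensor" where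
  "pure_tensor x = (\<chi> \<nu>. \<Prod>j\<in>UNIV. x j $ \<nu> j)"

definition std_basis :: "'m::finite \<Rightarrow> complex ^ 'm" where
  "std_basis i = axis i 1"

text \<open>
  The map \<open>g\<^sup>\<otimes>\<^sup>D\<close>, as the linear extension of
  \<open>e\<^bsub>\<nu>\<^sub>1\<^esub> \<otimes> \<dots> \<otimes> e\<^bsub>\<nu>\<^sub>D\<^esub> \<mapsto> g e\<^bsub>\<nu>\<^sub>1\<^esub> \<otimes> \<dots> \<otimes> g e\<^bsub>\<nu>\<^sub>D\<^esub>\<close>.
\<close>
definition tensor_act ::
  "complex ^ 'm ^ 'm \<Rightarrow> ('d::finite, 'm::finite) tensor \<Rightarrow> ('d, 'm) tensor" where
  "tensor_act g v = (\<Sum>\<nu>\<in>UNIV. v $ \<nu> *s pure_tensor (\<lambda>j. g *v std_basis (\<nu> j)))"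

text \<open>The symmetric tensor identified with the form \<open>X\<^sub>1\<^sup>D + \<dots> + X\<^sub>m\<^sup>D\<close>.\<close>
definition power_sum_tensor :: "('d::finite, 'm::finite) tensor" where
  "power_sum_tensor = (\<Sum>i\<in>UNIV. pure_tensor (\<lambda>_. std_basis i))"

definition P_inv :: "('d::finite, 'm::finite) tensor \<Rightarrow> complex" where
  "P_inv v = (\<Sum>\<sigma> | \<forall>j. \<sigma> j permutes (UNIV :: 'm set).
     (\<Prod>j\<in>UNIV. of_int (sign (\<sigma> j))) * (\<Prod>i\<in>UNIV. v $ (\<lambda>j. \<sigma> j i)))"

lemma tensor_expansion:
  fixes v :: "('d::finite, 'm::finite) tensor"
  shows "v = (\<Sum>\<nu>\<in>UNIV. v $ \<nu> *s pure_tensor (\<lambda>j. std_basis (\<nu> j)))"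
proof -
  have basis: "pure_tensor (\<lambda>j. std_basis (\<nu> j)) $ \<mu> = (if \<nu> = \<mu> then 1 else 0)"
    for \<nu> \<mu> :: "'d \<Rightarrow> 'm"
  proof (cases "\<nu> = \<mu>")
    case False
    then obtain j where "\<nu> j \<noteq> \<mu> j"
      by auto
    then have "std_basis (\<nu> j) $ \<mu> j = 0"
      by (simp add: std_basis_def axis_def)
    with False show ?thesis
      by (auto simp: pure_tensor_def)
  qed (simp add: pure_tensor_def std_basis_def axis_def)
  show ?thesis
    unfolding vec_eq_iff by (simp add: basis if_distrib del: if_split cong: if_cong)
qed

lemma tensor_act_pure_tensor:
  fixes x :: "'d::finite \<Rightarrow> complex ^ 'm::finite"
  shows "tensor_act g (pure_tensor x) = pure_tensor (\<lambda>j. g *v x j)"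
proof -
  have "(\<Sum>\<nu>\<in>UNIV. (\<Prod>j\<in>UNIV. x j $ \<nu> j) * (\<Prod>j\<in>UNIV. g $ \<mu> j $ \<nu> j)) =
      (\<Prod>j\<in>UNIV. \<Sum>k\<in>UNIV. g $ \<mu> j $ k * x j $ k)" for \<mu> :: "'d \<Rightarrow> 'm"
    using prod_sum_PiE[of "UNIV :: 'd set" "\<lambda>_. UNIV :: 'm set" "\<lambda>j k. g $ \<mu> j $ k * x j $ k"]
    by (simp add: PiE_UNIV_domain prod.distrib mult.commute)
  then show ?thesis
    by (simp add: tensor_act_def pure_tensor_def vec_eq_iff matrix_vector_mult_def
        std_basis_def axis_def if_distrib cong: if_cong)
qed

end

theory Submission
  imports Defs
begin

text \<open>
  Equivariance comes from expanding \<open>P_inv (tensor_act g v)\<close>. The coordinates of the transformed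
  tensor are sums over multi-indices, so the product over \<open>i\<close> becomes a sum over choices of one
  multi-index \<open>N i\<close> for every \<open>i\<close>. For a fixed choice the permutations \<open>\<sigma>\<^sub>j\<close> occur independently
  of each other, and summing over them yields a product over \<open>j\<close> of determinants: the \<open>j\<close>-th one is
  the determinant of the matrix whose columns are the columns of \<open>g\<close> with indices \<open>N i j\<close>
  (\<open>sum_sign_prod_columns\<close>). It vanishes unless \<open>i \<mapsto> N i j\<close> is a permutation and otherwise is
  \<open>det g\<close> times the sign of that permutation. The surviving choices are again \<open>D\<close>-tuples of
  permutations, and \<open>det g\<close> has been extracted once for each tensor factor.

  For the second part, composing all \<open>\<sigma>\<^sub>j\<close> on the right with one transposition only reorders the
  factors \<open>v(\<sigma>\<^sub>1(i), \<dots>, \<sigma>\<^sub>D(i))\<close> but multiplies the signs by \<open>(-1)\<^sup>D\<close>; hence \<open>P_inv\<close> vanishes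
  for odd \<open>D\<close>. On the power sum only the tuples with \<open>\<sigma>\<^sub>1 = \<dots> = \<sigma>\<^sub>D\<close> contribute, each with
  \<open>sgn(\<sigma>\<^sub>1)\<^sup>D\<close>, which is \<open>1\<close> for even \<open>D\<close>.
\<close>

text \<open>
  Up to transposition the left-hand side is the Leibniz expansion of the matrix with columns
  \<open>f i\<close> of \<open>g\<close>, so the alternating property of the determinant applies.
\<close>
lemma sum_sign_prod_columns:
  fixes g :: "'a::comm_ring_1 ^ 'm::finite ^ 'm" and f :: "'m \<Rightarrow> 'm"
  shows "(\<Sum>s | s permutes UNIV. of_int (sign s) * (\<Prod>i\<in>UNIV. g $ s i $ f i))
       = (if f permutes UNIV then of_int (sign f) else 0) * det g"
proof -
  define B where "B = (\<chi> i. transpose g $ f i)"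
  have "(\<Sum>s | s permutes UNIV. of_int (sign s) * (\<Prod>i\<in>UNIV. g $ s i $ f i)) = det B"
    by (simp add: det_def B_def transpose_def)
  moreover have "det B = of_int (sign f) * det g" if "f permutes UNIV"
    using det_permute_rows[OF that, of "transpose g"] by (simp add: B_def)
  moreover have "det B = 0" if "\<not> f permutes UNIV"
  proof -
    have "\<not> inj f"
      using that bij_imp_permutes[of f UNIV] by (auto simp: bij_def finite_UNIV_inj_surj)
    then obtain i k where "i \<noteq> k" "f i = f k"
      by (auto simp: inj_def)
    then show ?thesis
      by (intro det_identical_rows[of i k]) (simp_all add: B_def row_def)
  qed
  ultimately show ?thesis
    by simp
qed

lemma prod_sum_functions:
  fixes F :: "'a::finite \<Rightarrow> 'b \<Rightarrow> 'c::comm_semiring_1"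
  assumes "finite B"
  shows "(\<Prod>a\<in>UNIV. \<Sum>b\<in>B. F a b) = (\<Sum>h | \<forall>a. h a \<in> B. \<Prod>a\<in>UNIV. F a (h a))"
  using prod_sum_PiE[of "UNIV :: 'a set" "\<lambda>_. B" F] assms by (simp add: PiE_UNIV_domain Pi_def)

lemma tensor_act_coord:
  "tensor_act g v $ \<mu> = (\<Sum>\<nu>\<in>UNIV. v $ \<nu> * (\<Prod>j\<in>UNIV. g $ \<mu> j $ \<nu> j))"
  by (simp add: tensor_act_def pure_tensor_def matrix_vector_mult_def
      std_basis_def axis_def if_distrib cong: if_cong)

text \<open>
  Expanding the transformed tensor yields a sum over arbitrary choices of multi-indices, in which
  the non-permutations carry coefficient zero; this form of \<open>P_inv\<close> matches it term by term.
\<close>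
lemma P_inv_eq_sum_all_maps:
  fixes v :: "('d::finite, 'm::finite) tensor"
  shows "P_inv v = (\<Sum>\<sigma>\<in>UNIV. (\<Prod>j\<in>UNIV. if \<sigma> j permutes UNIV then of_int (sign (\<sigma> j)) else 0) *
           (\<Prod>i\<in>UNIV. v $ (\<lambda>j. \<sigma> j i)))"
proof -
  have "(\<Prod>j\<in>UNIV. if \<sigma> j permutes UNIV then of_int (sign (\<sigma> j)) else 0 :: complex) =
      (if \<forall>j. \<sigma> j permutes UNIV then \<Prod>j\<in>UNIV. of_int (sign (\<sigma> j)) else 0)"
    for \<sigma> :: "'d \<Rightarrow> 'm \<Rightarrow> 'm"
    by auto
  then show ?thesis
    unfolding P_inv_def by (intro sum.mono_neutral_cong_left) auto
qed

theorem P_inv_tensor_act: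
  fixes g :: "complex ^ 'm::finite ^ 'm" and v :: "('d::finite, 'm) tensor"
  shows "P_inv (tensor_act g v) = det g ^ CARD('d) * P_inv v"
proof -
  let ?S = "{\<sigma> :: 'd \<Rightarrow> 'm \<Rightarrow> 'm. \<forall>j. \<sigma> j permutes UNIV}"
  let ?c = "\<lambda>f :: 'm \<Rightarrow> 'm. if f permutes UNIV then of_int (sign f) else 0 :: complex"
  have "P_inv (tensor_act g v) = (\<Sum>\<sigma>\<in>?S. (\<Prod>j\<in>UNIV. of_int (sign (\<sigma> j))) *
      (\<Sum>N\<in>UNIV. \<Prod>i\<in>UNIV. v $ N i * (\<Prod>j\<in>UNIV. g $ \<sigma> j i $ N i j)))"
    by (simp add: P_inv_def tensor_act_coord prod_sum_functions)
  also have "\<dots> = (\<Sum>N\<in>UNIV. \<Sum>\<sigma>\<in>?S. (\<Prod>j\<in>UNIV. of_int (sign (\<sigma> j))) *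
      (\<Prod>i\<in>UNIV. v $ N i * (\<Prod>j\<in>UNIV. g $ \<sigma> j i $ N i j)))"
    unfolding sum_distrib_left by (rule sum.swap)
  also have "\<dots> = (\<Sum>N\<in>UNIV. (\<Prod>i\<in>UNIV. v $ N i) *
      (\<Sum>\<sigma>\<in>?S. \<Prod>j\<in>UNIV. of_int (sign (\<sigma> j)) * (\<Prod>i\<in>UNIV. g $ \<sigma> j i $ N i j)))"
  proof (intro sum.cong refl)
    fix N :: "'m \<Rightarrow> 'd \<Rightarrow> 'm"
    have "(\<Prod>i\<in>UNIV. \<Prod>j\<in>UNIV. g $ \<sigma> j i $ N i j) = (\<Prod>j\<in>UNIV. \<Prod>i\<in>UNIV. g $ \<sigma> j i $ N i j)"
      for \<sigma> :: "'d \<Rightarrow> 'm \<Rightarrow> 'm"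
      by (rule prod.swap)
    then show "(\<Sum>\<sigma>\<in>?S. (\<Prod>j\<in>UNIV. of_int (sign (\<sigma> j))) *
          (\<Prod>i\<in>UNIV. v $ N i * (\<Prod>j\<in>UNIV. g $ \<sigma> j i $ N i j))) =
        (\<Prod>i\<in>UNIV. v $ N i) *
          (\<Sum>\<sigma>\<in>?S. \<Prod>j\<in>UNIV. of_int (sign (\<sigma> j)) * (\<Prod>i\<in>UNIV. g $ \<sigma> j i $ N i j))"
      by (simp add: prod.distrib sum_distrib_left mult_ac)
  qed
  also have "\<dots> = (\<Sum>N\<in>UNIV. (\<Prod>i\<in>UNIV. v $ N i) * (\<Prod>j\<in>UNIV. ?c (\<lambda>i. N i j) * det g))"
    using prod_sum_functions[of "{s. s permutes (UNIV :: 'm set)}"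
        "\<lambda>(j :: 'd) s. of_int (sign s) * (\<Prod>i\<in>UNIV. g $ s i $ N i j)" for N]
    by (simp add: sum_sign_prod_columns)
  also have "\<dots> = (\<Sum>\<sigma>\<in>UNIV. (\<Prod>i\<in>UNIV. v $ (\<lambda>j. \<sigma> j i)) * (\<Prod>j\<in>UNIV. ?c (\<sigma> j) * det g))"
    by (rule sum.reindex_bij_witness[of _ "\<lambda>\<sigma> i j. \<sigma> j i" "\<lambda>N j i. N i j"]) auto
  also have "\<dots> = det g ^ CARD('d) * P_inv v"
    by (simp add: P_inv_eq_sum_all_maps prod.distrib sum_distrib_left mult_ac)
  finally show ?thesis .
qed

text \<open>
  The factor \<open>-1\<close> arises once for each \<open>\<sigma>\<^sub>j\<close> when all of them are composed with one common
  transposition, which exists because \<open>'m\<close> has two distinct elements.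
\<close>
lemma P_inv_eq_minus_one_power:
  fixes v :: "('d::finite, 'm::finite) tensor"
  assumes "CARD('m) \<ge> 2"
  shows "P_inv v = (-1) ^ CARD('d) * P_inv v"
proof -
  obtain a b :: 'm where "a \<noteq> b"
    using assms by (metis card_2_iff' ex_card)
  define t where "t = Transposition.transpose a b"
  have t: "t permutes UNIV" "t \<circ> t = id" "sign t = -1"
    using \<open>a \<noteq> b\<close> by (simp_all add: t_def permutes_swap_id sign_swap_id)
  have sign_t: "sign (p \<circ> t) = - sign p" if "p permutes UNIV" for p
    using that t by (simp add: sign_compose permutation_permutes[THEN iffD2] exI[of _ UNIV])
  have "P_inv v = (\<Sum>\<sigma> | \<forall>j. \<sigma> j permutes (UNIV :: 'm set).
      (\<Prod>j\<in>UNIV. - of_int (sign (\<sigma> j))) * (\<Prod>i\<in>UNIV. v $ (\<lambda>j. \<sigma> j i)))"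
    unfolding P_inv_def
  proof (rule sum.reindex_bij_witness[of _ "\<lambda>\<sigma> j. \<sigma> j \<circ> t" "\<lambda>\<sigma> j. \<sigma> j \<circ> t"])
    fix \<sigma> :: "'d \<Rightarrow> 'm \<Rightarrow> 'm"
    assume "\<sigma> \<in> {\<sigma>. \<forall>j. \<sigma> j permutes UNIV}"
    then have \<sigma>: "\<And>j. \<sigma> j permutes UNIV"
      by simp
    have "(\<Prod>i\<in>UNIV. v $ (\<lambda>j. \<sigma> j i)) = (\<Prod>i\<in>UNIV. v $ (\<lambda>j. \<sigma> j (t i)))"
      using prod.permute[OF t(1), of "\<lambda>i. v $ (\<lambda>j. \<sigma> j i)"] by (simp add: o_def)
    then show "(\<Prod>j\<in>UNIV. - of_int (sign (\<sigma> j \<circ> t))) * (\<Prod>i\<in>UNIV. v $ (\<lambda>j. (\<sigma> j \<circ> t) i)) =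
        (\<Prod>j\<in>UNIV. of_int (sign (\<sigma> j))) * (\<Prod>i\<in>UNIV. v $ (\<lambda>j. \<sigma> j i))"
      by (simp add: sign_t[OF \<sigma>])
  qed (use t in \<open>auto simp: o_assoc[symmetric] intro: permutes_compose\<close>)
  also have "\<dots> = (-1) ^ CARD('d) * P_inv v"
    by (simp add: P_inv_def prod_uminus sum_distrib_left mult_ac)
  finally show ?thesis .
qed

lemma power_sum_tensor_coord:
  "(power_sum_tensor :: ('d::finite, 'm::finite) tensor) $ \<nu> =
    (if \<exists>k. \<nu> = (\<lambda>_. k) then 1 else 0)"
proof -
  have pure: "pure_tensor (\<lambda>_. std_basis k) $ \<nu> = (if \<nu> = (\<lambda>_. k) then 1 else 0)" for k
  proof (cases "\<nu> = (\<lambda>_. k)")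
    case False
    then obtain j where "\<nu> j \<noteq> k"
      by auto
    then have "std_basis k $ \<nu> j = 0"
      by (simp add: std_basis_def axis_def)
    with False show ?thesis
      by (auto simp: pure_tensor_def)
  qed (simp add: pure_tensor_def std_basis_def axis_def)
  show ?thesis
  proof (cases "\<exists>k. \<nu> = (\<lambda>_. k)")
    case True
    then obtain k where k: "\<nu> = (\<lambda>_. k)" by blast
    then have "(\<nu> = (\<lambda>_. l)) = (l = k)" for l
      by (auto simp: fun_eq_iff)
    with True show ?thesis
      by (simp add: power_sum_tensor_def pure)
  qed (simp add: power_sum_tensor_def pure)
qed

theorem P_inv_power_sum:
  assumes "even CARD('d)"
  shows "P_inv (power_sum_tensor :: ('d::finite, 'm::finite) tensor) = fact CARD('m)"
proof -
  let ?w = "power_sum_tensor :: ('d, 'm) tensor"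
  let ?perms = "{p. p permutes (UNIV :: 'm set)}"
  have inj: "inj_on (\<lambda>p (_ :: 'd). p) ?perms"
    by (auto simp: inj_on_def fun_eq_iff)
  \<comment> \<open>A nonzero factor at \<open>i\<close> forces all \<open>\<sigma>\<^sub>j(i)\<close> to agree, so a nonzero product forces all \<open>\<sigma>\<^sub>j\<close> to agree.\<close>
  have vanish: "(\<Prod>i\<in>UNIV. ?w $ (\<lambda>j. \<sigma> j i)) = 0"
    if not_const: "\<nexists>p. \<sigma> = (\<lambda>_. p)" for \<sigma> :: "'d \<Rightarrow> 'm \<Rightarrow> 'm"
  proof -
    have "\<exists>i. \<nexists>k. (\<lambda>j. \<sigma> j i) = (\<lambda>_. k)"
    proof (rule ccontr)
      assume "\<not> ?thesis"
      then have "\<forall>i. \<exists>k. \<forall>j. \<sigma> j i = k"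
        by (auto simp: fun_eq_iff)
      then obtain p where "\<forall>i j. \<sigma> j i = p i"
        by metis
      with not_const show False
        by (auto simp: fun_eq_iff)
    qed
    then show ?thesis
      by (auto simp: power_sum_tensor_coord)
  qed
  have "P_inv ?w = (\<Sum>\<sigma>\<in>(\<lambda>p _. p) ` ?perms.
      (\<Prod>j\<in>UNIV. of_int (sign (\<sigma> j))) * (\<Prod>i\<in>UNIV. ?w $ (\<lambda>j. \<sigma> j i)))"
    unfolding P_inv_def by (rule sum.mono_neutral_right) (auto simp del: prod_zero_iff intro!: vanish)
  also have "\<dots> = (\<Sum>p\<in>?perms. of_int (sign p) ^ CARD('d))"
    by (subst sum.reindex[OF inj]) (auto simp: power_sum_tensor_coord fun_eq_iff intro!: sum.cong prod.neutral)
  also have "\<dots> = (\<Sum>p\<in>?perms. 1)"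
    using assms by (intro sum.cong refl) (simp add: sign_def)
  also have "\<dots> = fact CARD('m)"
    by (simp add: card_permutations[OF refl])
  finally show ?thesis .
qed

theorem theorem3p18:
  shows "(\<forall>(g :: complex ^ 'm::finite ^ 'm) (v :: ('d::finite, 'm) tensor).
            invertible g \<longrightarrow> P_inv (tensor_act g v) = det g ^ CARD('d) * P_inv v)
       \<and> (CARD('m) \<ge> 2 \<longrightarrow>
            ((P_inv :: ('d, 'm) tensor \<Rightarrow> complex) \<noteq> (\<lambda>_. 0) \<longleftrightarrow> even CARD('d))
          \<and> (even CARD('d) \<longrightarrow>
               P_inv (power_sum_tensor :: ('d, 'm) tensor) = fact CARD('m)
             \<and> (fact CARD('m) :: complex) \<noteq> 0))"
proof (intro conjI impI allI)
  fix g :: "complex ^ 'm ^ 'm" and v :: "('d, 'm) tensor"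
  show "P_inv (tensor_act g v) = det g ^ CARD('d) * P_inv v"
    by (rule P_inv_tensor_act)
next
  assume m: "CARD('m) \<ge> 2"
  show "(P_inv :: ('d, 'm) tensor \<Rightarrow> complex) \<noteq> (\<lambda>_. 0) \<longleftrightarrow> even CARD('d)"
  proof
    assume nz: "(P_inv :: ('d, 'm) tensor \<Rightarrow> complex) \<noteq> (\<lambda>_. 0)"
    show "even CARD('d)"
    proof (rule ccontr)
      assume "odd CARD('d)"
      then have "P_inv v = - P_inv v" for v :: "('d, 'm) tensor"
        using P_inv_eq_minus_one_power[OF m, of v] by simp
      with nz show False
        by (auto simp: fun_eq_iff)
    qed
  next
    assume "even CARD('d)"
    then have "P_inv (power_sum_tensor :: ('d, 'm) tensor) \<noteq> 0"
      by (simp add: P_inv_power_sum)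
    then show "(P_inv :: ('d, 'm) tensor \<Rightarrow> complex) \<noteq> (\<lambda>_. 0)"
      by metis
  qed
next
  assume "even CARD('d)"
  then show "P_inv (power_sum_tensor :: ('d, 'm) tensor) = fact CARD('m)"
    by (rule P_inv_power_sum)
next
  show "(fact CARD('m) :: complex) \<noteq> 0"
    by simp
qed

end
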